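(* Let $D=(V,A)$ be a loop-free digraph with a weight function $w:A\to\mathbb{R}_+\cup\{+\infty\}$ and let $f:V\to\mathbb{R}_+\cup\{-\infty\}$. The problem of deciding whether there is an ordering of $V$ with $\delta^{\ell}_w(v)\ge f(v)$ for every $v\in V$ (the $(f,+\infty;\sum w)$-bounded ordering problem), and finding such an ordering if one exists, is solvable in polynomial time. Such an ordering exists if and only if there is no nonempty induced subgraph $D'=(V',A')$ of $D$ such that $\delta_w(v,V\setminus V')<f(v)$ holds for each vertex $v\in V'$.
   Context: Digraphs are finite and loop-free; parallel arcs are allowed. $\mathbb{R}_+$ denotes the nonnegative reals. For $v\in V$ and $U\subseteq V$, $\delta_w(v,U)$ is the sum of the weights $w(a)$ over all arcs $a$ from $v$ to vertices of $U$. For an ordering $\sigma=(\sigma_1,\dots,\sigma_n)$ of $V$ and $v=\sigma_i$, the weighted left-outdegree is $\delta^{\ell}_w(v)=\delta_w(v,\{\sigma_1,\dots,\sigma_{i-1}\})$. *)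

theory Defs
  imports
    "Graph_Theory.Digraph_Component"
    "HOL-Library.Extended_Real"
    "HOL-Computational_Algebra.Polynomial"
begin

section \<open>Bounded orderings of weighted digraphs\<close>

text \<open>
  Weights take values in \<open>[0, \<infinity>]\<close> and lower bounds in \<open>[0, \<infinity>) \<union> {-\<infinity>}\<close>. Both are modelled in
  \<^typ>\<open>ereal\<close>. Parallel arcs are allowed, since \<^const>\<open>nomulti_digraph\<close> is not required.
\<close>

definition bounded_ordering_instance ::
  "('a, 'b) pre_digraph \<Rightarrow> ('b \<Rightarrow> ereal) \<Rightarrow> ('a \<Rightarrow> ereal) \<Rightarrow> bool" where
  "bounded_ordering_instance D w f \<longleftrightarrow>
     fin_digraph D \<and> loopfree_digraph D \<and>
     (\<forall>a\<in>arcs D. 0 \<le> w a) \<and>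
     (\<forall>v\<in>verts D. f v = -\<infinity> \<or> (0 \<le> f v \<and> f v < \<infinity>))"

definition weight_to ::
  "('a, 'b) pre_digraph \<Rightarrow> ('b \<Rightarrow> ereal) \<Rightarrow> 'a \<Rightarrow> 'a set \<Rightarrow> ereal" where
  "weight_to D w v U = (\<Sum>a\<in>{a \<in> arcs D. tail D a = v \<and> head D a \<in> U}. w a)"

definition vertex_ordering :: "('a, 'b) pre_digraph \<Rightarrow> 'a list \<Rightarrow> bool" where
  "vertex_ordering D \<sigma> \<longleftrightarrow> distinct \<sigma> \<and> set \<sigma> = verts D"

text \<open>The weighted left-outdegree of the vertex at position \<open>i\<close> of \<open>\<sigma>\<close>.\<close>

definition left_outdegree ::
  "('a, 'b) pre_digraph \<Rightarrow> ('b \<Rightarrow> ereal) \<Rightarrow> 'a list \<Rightarrow> nat \<Rightarrow> ereal" where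
  "left_outdegree D w \<sigma> i = weight_to D w (\<sigma> ! i) (set (take i \<sigma>))"

definition bounded_ordering ::
  "('a, 'b) pre_digraph \<Rightarrow> ('b \<Rightarrow> ereal) \<Rightarrow> ('a \<Rightarrow> ereal) \<Rightarrow> 'a list \<Rightarrow> bool" where
  "bounded_ordering D w f \<sigma> \<longleftrightarrow>
     vertex_ordering D \<sigma> \<and> (\<forall>i<length \<sigma>. left_outdegree D w \<sigma> i \<ge> f (\<sigma> ! i))"


section \<open>An additive real-number random access machine\<close>

text \<open>
  As the weights are real numbers, running time is measured in the algebraic (real RAM) model
  used for strongly polynomial algorithms. A state consists of named arrays of natural numbers
  (for indices) and named arrays of extended reals (for data). A scalar is the entry \<open>0\<close> of an
  array. A program is a finite object fixed once and for all, hence uses finitely many arrays.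

  The instruction set is deliberately weak. On data there are only addition, comparison and the
  constant \<open>0\<close>: no other real constants (which could carry advice), no rounding, and no passage
  from data to indices other than by branching. On indices there are addition, truncated
  subtraction and comparison, but no multiplication. Hence numbers cannot be built up by
  repeated squaring: on instances with rational data the bit length of every number that occurs
  is polynomial in the bit length of the input and the number of steps, so a polynomial bound on
  the number of steps implies polynomial running time on a Turing machine.
\<close>

type_synonym array = string

record ram_state =
  idx :: "array \<Rightarrow> nat \<Rightarrow> nat"
  num :: "array \<Rightarrow> nat \<Rightarrow> ereal"

datatype iexp = IConst nat | IRead array iexp | IAdd iexp iexp | ISub iexp iexp

datatype nexp = NZero | NRead array iexp | NAdd nexp nexp

datatype test = ILess iexp iexp | NLess nexp nexp | TNot test | TAnd test test

datatype prog =
    PSkip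
  | IWrite array iexp iexp
  | NWrite array iexp nexp
  | PSeq prog prog
  | PIf test prog prog
  | PWhile test prog

primrec ival :: "iexp \<Rightarrow> ram_state \<Rightarrow> nat" where
  "ival (IConst c) s = c"
| "ival (IRead x i) s = idx s x (ival i s)"
| "ival (IAdd i j) s = ival i s + ival j s"
| "ival (ISub i j) s = ival i s - ival j s"

primrec nval :: "nexp \<Rightarrow> ram_state \<Rightarrow> ereal" where
  "nval NZero s = 0"
| "nval (NRead x i) s = num s x (ival i s)"
| "nval (NAdd d e) s = nval d s + nval e s"

primrec tval :: "test \<Rightarrow> ram_state \<Rightarrow> bool" where
  "tval (ILess i j) s \<longleftrightarrow> ival i s < ival j s"
| "tval (NLess d e) s \<longleftrightarrow> nval d s < nval e s"
| "tval (TNot b) s \<longleftrightarrow> \<not> tval b s"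
| "tval (TAnd b c) s \<longleftrightarrow> tval b s \<and> tval c s"

text \<open>Every operation performed in the evaluation of an expression costs one step.\<close>

primrec icost :: "iexp \<Rightarrow> nat" where
  "icost (IConst c) = 1"
| "icost (IRead x i) = icost i + 1"
| "icost (IAdd i j) = icost i + icost j + 1"
| "icost (ISub i j) = icost i + icost j + 1"

primrec ncost :: "nexp \<Rightarrow> nat" where
  "ncost NZero = 1"
| "ncost (NRead x i) = icost i + 1"
| "ncost (NAdd d e) = ncost d + ncost e + 1"

primrec tcost :: "test \<Rightarrow> nat" where
  "tcost (ILess i j) = icost i + icost j + 1"
| "tcost (NLess d e) = ncost d + ncost e + 1"
| "tcost (TNot b) = tcost b + 1"
| "tcost (TAnd b c) = tcost b + tcost c + 1"

definition iupd :: "array \<Rightarrow> nat \<Rightarrow> nat \<Rightarrow> ram_state \<Rightarrow> ram_state" where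
  "iupd x i c s = s\<lparr>idx := (idx s)(x := (idx s x)(i := c))\<rparr>"

definition nupd :: "array \<Rightarrow> nat \<Rightarrow> ereal \<Rightarrow> ram_state \<Rightarrow> ram_state" where
  "nupd x i c s = s\<lparr>num := (num s)(x := (num s x)(i := c))\<rparr>"

text \<open>\<open>runs p s k t\<close>: started in state \<open>s\<close>, program \<open>p\<close> halts in state \<open>t\<close> after \<open>k\<close> steps.\<close>

inductive runs :: "prog \<Rightarrow> ram_state \<Rightarrow> nat \<Rightarrow> ram_state \<Rightarrow> bool" where
  Skip: "runs PSkip s 1 s"
| IWrite: "runs (IWrite x i j) s (icost i + icost j + 1) (iupd x (ival i s) (ival j s) s)"
| NWrite: "runs (NWrite x i e) s (icost i + ncost e + 1) (nupd x (ival i s) (nval e s) s)"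
| Seq: "runs p s k t \<Longrightarrow> runs q t l u \<Longrightarrow> runs (PSeq p q) s (k + l) u"
| IfTrue: "tval b s \<Longrightarrow> runs p s k t \<Longrightarrow> runs (PIf b p q) s (tcost b + k) t"
| IfFalse: "\<not> tval b s \<Longrightarrow> runs q s k t \<Longrightarrow> runs (PIf b p q) s (tcost b + k) t"
| WhileFalse: "\<not> tval b s \<Longrightarrow> runs (PWhile b p) s (tcost b) s"
| WhileTrue: "tval b s \<Longrightarrow> runs p s k t \<Longrightarrow> runs (PWhile b p) t l u \<Longrightarrow>
    runs (PWhile b p) s (tcost b + k + l) u"

inductive_cases PSkipE: "runs PSkip s k t"
inductive_cases IWriteE: "runs (IWrite x i j) s k t"
inductive_cases NWriteE: "runs (NWrite x i e) s k t"
inductive_cases PSeqE: "runs (PSeq p q) s k t"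
inductive_cases PIfE: "runs (PIf b p q) s k t"
inductive_cases PWhileE: "runs (PWhile b p) s k t"

lemma runs_deterministic:
  "runs p s k t \<Longrightarrow> runs p s l u \<Longrightarrow> k = l \<and> t = u"
proof (induction arbitrary: l u rule: runs.induct)
  case (Seq p s k t q k' t')
  from Seq.prems show ?case by (rule PSeqE) (use Seq.IH in blast)
next
  case (IfTrue b s p k t q)
  from IfTrue.prems show ?case by (rule PIfE) (use IfTrue.hyps IfTrue.IH in blast)+
next
  case (IfFalse b s q k t p)
  from IfFalse.prems show ?case by (rule PIfE) (use IfFalse.hyps IfFalse.IH in blast)+
next
  case (WhileFalse b s p)
  from WhileFalse.prems show ?case by (rule PWhileE) (use WhileFalse.hyps in blast)+
next
  case (WhileTrue b s p k t k' t')
  from WhileTrue.prems show ?case by (rule PWhileE) (use WhileTrue.hyps WhileTrue.IH in blast)+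
qed (erule PSkipE IWriteE NWriteE, simp)+

text \<open>
  A problem is given by its set \<open>I\<close> of instances, their encodings \<open>enc\<close> as initial states, their
  size \<open>sz\<close>, and the relation \<open>correct\<close> between instances and admissible final states.
\<close>

definition polynomial_time_solvable ::
  "'i set \<Rightarrow> ('i \<Rightarrow> ram_state) \<Rightarrow> ('i \<Rightarrow> nat) \<Rightarrow> ('i \<Rightarrow> ram_state \<Rightarrow> bool) \<Rightarrow> bool" where
  "polynomial_time_solvable I enc sz correct \<longleftrightarrow>
     (\<exists>(p :: prog) (b :: nat poly). \<forall>x\<in>I. \<exists>k t.
        runs p (enc x) k t \<and> k \<le> poly b (sz x) \<and> correct x t)"


section \<open>The computational problem\<close>

text \<open>
  Up to renaming of vertices and arcs, every finite digraph has vertices \<open>0, \<dots>, n - 1\<close> and arcs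
  \<open>0, \<dots>, m - 1\<close>. In this form it is handed to an algorithm, together with the weights and bounds,
  as arrays indexed by arcs and by vertices.
\<close>

type_synonym numbered_instance =
  "(nat, nat) pre_digraph \<times> (nat \<Rightarrow> ereal) \<times> (nat \<Rightarrow> ereal)"

definition numbered_instances :: "numbered_instance set" where
  "numbered_instances = {(D, w, f). bounded_ordering_instance D w f \<and>
     (\<exists>n m. verts D = {..<n} \<and> arcs D = {..<m})}"

definition encode :: "numbered_instance \<Rightarrow> ram_state" where
  "encode = (\<lambda>(D, w, f). \<lparr>
     idx = (\<lambda>x i.
       if x = ''n'' \<and> i = 0 then card (verts D)
       else if x = ''m'' \<and> i = 0 then card (arcs D)
       else if x = ''tail'' \<and> i \<in> arcs D then tail D i
       else if x = ''head'' \<and> i \<in> arcs D then head D i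
       else 0),
     num = (\<lambda>x i.
       if x = ''w'' \<and> i \<in> arcs D then w i
       else if x = ''f'' \<and> i \<in> verts D then f i
       else 0)\<rparr>)"

definition instance_size :: "numbered_instance \<Rightarrow> nat" where
  "instance_size = (\<lambda>(D, w, f). card (verts D) + card (arcs D))"

text \<open>
  The algorithm has to decide existence of a bounded ordering (answer \<open>1\<close> or \<open>0\<close>) and, in case
  of existence, to output one in the array \<open>order\<close>.
\<close>

definition correct_output :: "numbered_instance \<Rightarrow> ram_state \<Rightarrow> bool" where
  "correct_output = (\<lambda>(D, w, f) t.
     if \<exists>\<sigma>. bounded_ordering D w f \<sigma>
     then idx t ''answer'' 0 = 1 \<and>
          bounded_ordering D w f (map (idx t ''order'') [0..<card (verts D)])
     else idx t ''answer'' 0 = 0)"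

end

theory Submission
  imports Defs
begin

text \<open>
  A list of distinct vertices in which every vertex meets its bound is a partial ordering. A
  vertex \<open>v\<close> outside it whose arcs into the list already weigh at least \<open>f v\<close> can be appended.
  If no vertex can be appended and some vertices are missing, then the set \<open>U\<close> of the missing
  ones satisfies \<open>weight_to D w v (verts D - U) < f v\<close> for all \<open>v \<in> U\<close>; such a set is called
  blocking (\<open>blocking_set_if_stuck\<close>). A blocking set excludes every bounded ordering, because
  the first of its members in the ordering has all its left out-neighbours outside the set and
  the weights are nonnegative (\<open>not_bounded_ordering_if_blocking_set\<close>). So extending a partial
  ordering greedily, without ever revising a choice, either ends in a bounded ordering or proves
  that there is none.

  The machine program keeps, for each vertex, the weight of its arcs into the current partial
  ordering. A cursor runs through the vertices and returns to \<open>0\<close> after each appended vertex, so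
  when it reaches \<open>n\<close> no vertex can be appended. There are at most \<open>n\<close>
  successes, and the cursor moves at most \<open>n\<close> times before, between and after them. A success
  also costs one pass over the \<open>m\<close> arcs to update the stored weights. Charging such a pass to
  every move of the cursor bounds the running time by a constant times \<open>(n + 1)\<^sup>2 (m + 1)\<close>.
\<close>

section \<open>Partial orderings and blocking sets\<close>

text \<open>An initial segment of a potential bounded ordering.\<close>

definition partial_ordering ::
  "('a, 'b) pre_digraph \<Rightarrow> ('b \<Rightarrow> ereal) \<Rightarrow> ('a \<Rightarrow> ereal) \<Rightarrow> 'a list \<Rightarrow> bool" where
  "partial_ordering D w f L \<longleftrightarrow> distinct L \<and> set L \<subseteq> verts D \<and>
     (\<forall>i<length L. f (L ! i) \<le> left_outdegree D w L i)"

text \<open>The vertex set of an induced subgraph that obstructs bounded orderings.\<close>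

definition blocking_set ::
  "('a, 'b) pre_digraph \<Rightarrow> ('b \<Rightarrow> ereal) \<Rightarrow> ('a \<Rightarrow> ereal) \<Rightarrow> 'a set \<Rightarrow> bool" where
  "blocking_set D w f U \<longleftrightarrow> U \<subseteq> verts D \<and> U \<noteq> {} \<and>
     (\<forall>v\<in>U. weight_to D w v (verts D - U) < f v)"

lemma bounded_ordering_iff_partial:
  "bounded_ordering D w f L \<longleftrightarrow> partial_ordering D w f L \<and> set L = verts D"
  by (auto simp: bounded_ordering_def vertex_ordering_def partial_ordering_def)

lemma partial_ordering_Nil: "partial_ordering D w f []"
  by (simp add: partial_ordering_def)

lemma partial_ordering_snoc:
  assumes "partial_ordering D w f L" "v \<in> verts D" "v \<notin> set L" "f v \<le> weight_to D w v (set L)"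
  shows "partial_ordering D w f (L @ [v])"
  using assms by (auto simp: partial_ordering_def left_outdegree_def nth_append less_Suc_eq)

lemma weight_to_empty [simp]: "weight_to D w v {} = 0"
  by (simp add: weight_to_def)

lemma weight_to_mono:
  assumes "fin_digraph D" "\<And>a. a \<in> arcs D \<Longrightarrow> 0 \<le> w a" "S \<subseteq> T"
  shows "weight_to D w v S \<le> weight_to D w v T"
proof -
  interpret fin_digraph D by fact
  show ?thesis
    unfolding weight_to_def by (rule sum_mono2) (use assms in auto)
qed

lemma weight_to_insert:
  assumes "fin_digraph D" "x \<notin> S"
  shows "weight_to D w v (insert x S) = weight_to D w v S + weight_to D w v {x}"
proof -
  interpret fin_digraph D by fact
  have "{a \<in> arcs D. tail D a = v \<and> head D a \<in> insert x S} =
      {a \<in> arcs D. tail D a = v \<and> head D a \<in> S} \<union> {a \<in> arcs D. tail D a = v \<and> head D a \<in> {x}}"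
    by auto
  then show ?thesis
    unfolding weight_to_def using assms(2) by (simp only:) (rule sum.union_disjoint; auto)
qed

lemma blocking_set_if_stuck:
  assumes "set L \<subset> verts D" "\<And>v. v \<in> verts D - set L \<Longrightarrow> weight_to D w v (set L) < f v"
  shows "blocking_set D w f (verts D - set L)"
proof -
  have "verts D - (verts D - set L) = set L"
    using assms(1) by auto
  then show ?thesis
    using assms by (auto simp: blocking_set_def)
qed

lemma not_bounded_ordering_if_blocking_set:
  assumes inst: "bounded_ordering_instance D w f" and U: "blocking_set D w f U"
  shows "\<not> bounded_ordering D w f L"
proof
  assume L: "bounded_ordering D w f L"
  then have "set L = verts D"
    by (simp add: bounded_ordering_iff_partial)
  then have "\<exists>i. i < length L \<and> L ! i \<in> U"
    using U by (metis blocking_set_def ex_in_conv in_set_conv_nth subset_iff)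
  then obtain i where i: "i < length L" "L ! i \<in> U"
    and first: "\<And>j. j < i \<Longrightarrow> \<not> (j < length L \<and> L ! j \<in> U)"
    using exists_least_iff[of "\<lambda>i. i < length L \<and> L ! i \<in> U"] by blast
  have "set (take i L) \<subseteq> verts D - U"
    using i(1) first nth_mem[of _ L] \<open>set L = verts D\<close> by (auto simp: in_set_conv_nth)
  with inst have "weight_to D w (L ! i) (set (take i L)) \<le> weight_to D w (L ! i) (verts D - U)"
    by (intro weight_to_mono) (auto simp: bounded_ordering_instance_def)
  also have "\<dots> < f (L ! i)"
    using U i(2) by (simp add: blocking_set_def)
  also have "\<dots> \<le> weight_to D w (L ! i) (set (take i L))"
    using L i(1) by (simp add: bounded_ordering_def left_outdegree_def)
  finally show False by simp
qed

lemma ex_bounded_ordering_iff_no_blocking_set: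
  assumes inst: "bounded_ordering_instance D w f"
  shows "(\<exists>\<sigma>. bounded_ordering D w f \<sigma>) \<longleftrightarrow> \<not> (\<exists>U. blocking_set D w f U)"
proof
  assume "\<exists>\<sigma>. bounded_ordering D w f \<sigma>"
  then show "\<not> (\<exists>U. blocking_set D w f U)"
    using not_bounded_ordering_if_blocking_set[OF inst] by blast
next
  assume free: "\<not> (\<exists>U. blocking_set D w f U)"
  interpret fin_digraph D
    using inst by (simp add: bounded_ordering_instance_def)
  have "length L < Suc (card (verts D))" if "partial_ordering D w f L" for L
    using that card_mono[of "verts D" "set L"]
    by (simp add: partial_ordering_def distinct_card less_Suc_eq_le)
  then obtain L where L: "partial_ordering D w f L"
    and longest: "\<And>L'. partial_ordering D w f L' \<Longrightarrow> length L' \<le> length L"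
    using ex_has_greatest_nat[of "partial_ordering D w f", OF partial_ordering_Nil, of length]
    by (metis less_imp_le)
  have stuck: "weight_to D w v (set L) < f v" if "v \<in> verts D - set L" for v
    using longest[of "L @ [v]"] partial_ordering_snoc[OF L] that by fastforce
  have "set L = verts D"
    using blocking_set_if_stuck[OF _ stuck] L free by (auto simp: partial_ordering_def)
  with L show "\<exists>\<sigma>. bounded_ordering D w f \<sigma>"
    by (auto simp: bounded_ordering_iff_partial)
qed

lemma ex_blocking_set_iff_ex_induced_subgraph:
  assumes "wf_digraph D"
  shows "(\<exists>U. blocking_set D w f U) \<longleftrightarrow>
    (\<exists>D'. induced_subgraph D' D \<and> verts D' \<noteq> {} \<and>
      (\<forall>v\<in>verts D'. weight_to D w v (verts D - verts D') < f v))"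
proof
  assume "\<exists>U. blocking_set D w f U"
  then obtain U where U: "blocking_set D w f U" ..
  then have "induced_subgraph (D \<restriction> U) D"
    using wf_digraph.induced_induce[OF assms] by (simp add: blocking_set_def)
  with U show "\<exists>D'. induced_subgraph D' D \<and> verts D' \<noteq> {} \<and>
      (\<forall>v\<in>verts D'. weight_to D w v (verts D - verts D') < f v)"
    by (intro exI[of _ "D \<restriction> U"]) (simp add: blocking_set_def)
next
  assume "\<exists>D'. induced_subgraph D' D \<and> verts D' \<noteq> {} \<and>
      (\<forall>v\<in>verts D'. weight_to D w v (verts D - verts D') < f v)"
  then obtain D' where "induced_subgraph D' D" "verts D' \<noteq> {}"
      "\<forall>v\<in>verts D'. weight_to D w v (verts D - verts D') < f v"
    by blast
  then have "blocking_set D w f (verts D')"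
    by (auto simp: blocking_set_def induced_subgraph_def subgraph_def)
  then show "\<exists>U. blocking_set D w f U" ..
qed


section \<open>Total correctness with a time bound\<close>

text \<open>
  \<open>halts p s c Q\<close>: program \<open>p\<close>, started in state \<open>s\<close>, halts within \<open>c\<close> steps in a state that
  satisfies \<open>Q\<close>.
\<close>

definition halts :: "prog \<Rightarrow> ram_state \<Rightarrow> nat \<Rightarrow> (ram_state \<Rightarrow> bool) \<Rightarrow> bool" where
  "halts p s c Q \<longleftrightarrow> (\<exists>k t. runs p s k t \<and> k \<le> c \<and> Q t)"

lemma halts_mono:
  "halts p s c Q \<Longrightarrow> c \<le> c' \<Longrightarrow> (\<And>t. Q t \<Longrightarrow> Q' t) \<Longrightarrow> halts p s c' Q'"
  unfolding halts_def using le_trans by blast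

lemma halts_le: "halts p s c Q \<Longrightarrow> c \<le> c' \<Longrightarrow> halts p s c' Q"
  by (rule halts_mono)

lemma halts_PSkip: "Q s \<Longrightarrow> halts PSkip s 1 Q"
  unfolding halts_def using runs.Skip by blast

lemma halts_IWrite:
  "Q (iupd x (ival i s) (ival j s) s) \<Longrightarrow> halts (IWrite x i j) s (icost i + icost j + 1) Q"
  unfolding halts_def using runs.IWrite by blast

lemma halts_NWrite:
  "Q (nupd x (ival i s) (nval e s) s) \<Longrightarrow> halts (NWrite x i e) s (icost i + ncost e + 1) Q"
  unfolding halts_def using runs.NWrite by blast

lemma halts_PSeq:
  assumes "halts p s c (\<lambda>t. halts q t c' Q)"
  shows "halts (PSeq p q) s (c + c') Q"
  using assms unfolding halts_def by (meson runs.Seq add_mono)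

lemma halts_PIf:
  assumes "tval b s \<Longrightarrow> halts p s c Q" "\<not> tval b s \<Longrightarrow> halts q s c' Q"
  shows "halts (PIf b p q) s (tcost b + max c c') Q"
proof (cases "tval b s")
  case True
  then obtain k t where "runs p s k t" "k \<le> c" "Q t"
    using assms(1) by (auto simp: halts_def)
  with True show ?thesis
    unfolding halts_def by (intro exI[of _ "tcost b + k"] exI[of _ t]) (auto intro: runs.IfTrue)
next
  case False
  then obtain k t where "runs q s k t" "k \<le> c'" "Q t"
    using assms(2) by (auto simp: halts_def)
  with False show ?thesis
    unfolding halts_def by (intro exI[of _ "tcost b + k"] exI[of _ t]) (auto intro: runs.IfFalse)
qed

text \<open>The variant \<open>V\<close> bounds the number of iterations, the constant \<open>c\<close> the cost of each.\<close>

lemma halts_PWhile: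
  fixes V :: "ram_state \<Rightarrow> nat"
  assumes body: "\<And>s. I s \<Longrightarrow> tval b s \<Longrightarrow> halts p s c (\<lambda>t. I t \<and> V t < V s)"
    and "I s"
  shows "halts (PWhile b p) s (V s * (tcost b + c) + tcost b) (\<lambda>t. I t \<and> \<not> tval b t)"
  using \<open>I s\<close>
proof (induction "V s" arbitrary: s rule: less_induct)
  case less
  show ?case
  proof (cases "tval b s")
    case False
    then show ?thesis
      unfolding halts_def using less.prems by (blast intro: runs.WhileFalse le_add2)
  next
    case True
    obtain k t where kt: "runs p s k t" "k \<le> c" "I t" "V t < V s"
      using body[OF less.prems True] by (auto simp: halts_def)
    obtain l u where lu: "runs (PWhile b p) t l u" "l \<le> V t * (tcost b + c) + tcost b"
        "I u" "\<not> tval b u"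
      using less.hyps[OF kt(4,3)] by (auto simp: halts_def)
    have "Suc (V t) * (tcost b + c) \<le> V s * (tcost b + c)"
      using kt(4) by (intro mult_le_mono1) simp
    then have "tcost b + k + l \<le> V s * (tcost b + c) + tcost b"
      using kt(2) lu(2) by simp
    then show ?thesis
      unfolding halts_def using runs.WhileTrue[OF True kt(1) lu(1)] lu(3,4) by blast
  qed
qed

lemma idx_iupd [simp]: "idx (iupd x i c s) = (idx s)(x := (idx s x)(i := c))"
  and num_iupd [simp]: "num (iupd x i c s) = num s"
  and idx_nupd [simp]: "idx (nupd x i d s) = idx s"
  and num_nupd [simp]: "num (nupd x i d s) = (num s)(x := (num s x)(i := d))"
  by (simp_all add: iupd_def nupd_def)


section \<open>The greedy program\<close>

abbreviation scalar :: "array \<Rightarrow> iexp" where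
  "scalar x \<equiv> IRead x (IConst 0)"

abbreviation assign :: "array \<Rightarrow> iexp \<Rightarrow> prog" where
  "assign x e \<equiv> IWrite x (IConst 0) e"

abbreviation increment :: "array \<Rightarrow> prog" where
  "increment x \<equiv> assign x (IAdd (scalar x) (IConst 1))"

text \<open>
  Adds the weights of all arcs into the vertex \<open>j\<close> to the entries of \<open>d\<close> at their tails. The
  counter \<open>a\<close> has to be \<open>0\<close> initially.
\<close>

definition update_weights :: prog where
  "update_weights = PWhile (ILess (scalar ''a'') (scalar ''m''))
     (PSeq
       (PIf (TAnd (TNot (ILess (IRead ''head'' (scalar ''a'')) (scalar ''j'')))
                  (TNot (ILess (scalar ''j'') (IRead ''head'' (scalar ''a'')))))
         (NWrite ''d'' (IRead ''tail'' (scalar ''a''))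
            (NAdd (NRead ''d'' (IRead ''tail'' (scalar ''a''))) (NRead ''w'' (scalar ''a''))))
         PSkip)
       (increment ''a''))"

text \<open>
  The array \<open>order\<close> holds the current partial ordering in its first \<open>k\<close> entries, \<open>used\<close> marks
  its members, and \<open>d\<close> holds the weight of the arcs from each vertex into it. The cursor is \<open>j\<close>.
\<close>

definition greedy_step :: prog where
  "greedy_step =
     PIf (TAnd (ILess (IRead ''used'' (scalar ''j'')) (IConst 1))
               (TNot (NLess (NRead ''d'' (scalar ''j'')) (NRead ''f'' (scalar ''j'')))))
       (PSeq (IWrite ''order'' (scalar ''k'') (scalar ''j''))
       (PSeq (IWrite ''used'' (scalar ''j'') (IConst 1))
       (PSeq (increment ''k'')
       (PSeq (assign ''a'' (IConst 0))
       (PSeq update_weights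
             (assign ''j'' (IConst 0)))))))
       (increment ''j'')"

text \<open>
  No initialisation is needed, since all arrays other than those of the input are \<open>0\<close> at the start.
\<close>

definition greedy_program :: prog where
  "greedy_program =
     PSeq (PWhile (ILess (scalar ''j'') (scalar ''n'')) greedy_step)
          (PIf (ILess (scalar ''k'') (scalar ''n''))
             (assign ''answer'' (IConst 0))
             (assign ''answer'' (IConst 1)))"


section \<open>Correctness and running time of the program\<close>

text \<open>
  A single instance with vertices \<open>0, \<dots>, n - 1\<close> and arcs \<open>0, \<dots>, m - 1\<close>.
\<close>

locale numbered_instance =
  fixes D :: "(nat, nat) pre_digraph" and w f :: "nat \<Rightarrow> ereal" and n m :: nat
  assumes inst: "bounded_ordering_instance D w f"
    and verts_eq: "verts D = {..<n}" and arcs_eq: "arcs D = {..<m}"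
begin

sublocale fin_digraph D
  using inst by (simp add: bounded_ordering_instance_def)

text \<open>The input arrays still hold the instance, at all positions in range.\<close>

definition input_intact :: "ram_state \<Rightarrow> bool" where
  "input_intact s \<longleftrightarrow> idx s ''n'' 0 = n \<and> idx s ''m'' 0 = m \<and>
     (\<forall>a<m. idx s ''tail'' a = tail D a \<and> idx s ''head'' a = head D a \<and> num s ''w'' a = w a) \<and>
     (\<forall>v<n. num s ''f'' v = f v)"

text \<open>The weight of those arcs from \<open>v\<close> to \<open>x\<close> whose number is less than \<open>i\<close>.\<close>

definition weight_below :: "nat \<Rightarrow> nat \<Rightarrow> nat \<Rightarrow> ereal" where
  "weight_below i v x = (\<Sum>a\<in>{a. a < i \<and> tail D a = v \<and> head D a = x}. w a)"

lemma weight_below_0: "weight_below 0 v x = 0"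
  by (simp add: weight_below_def)

lemma weight_below_Suc:
  "weight_below (Suc i) v x =
     weight_below i v x + (if tail D i = v \<and> head D i = x then w i else 0)"
proof -
  have "{a. a < Suc i \<and> tail D a = v \<and> head D a = x} =
      (if tail D i = v \<and> head D i = x then insert i else id)
        {a. a < i \<and> tail D a = v \<and> head D a = x}"
    by (auto simp: less_Suc_eq)
  then show ?thesis
    by (simp add: weight_below_def add.commute)
qed

lemma weight_below_all: "weight_below m v x = weight_to D w v {x}"
  by (simp add: weight_below_def weight_to_def arcs_eq)

text \<open>The cost of one iteration, including the test, is at most \<open>38\<close>.\<close>

lemma halts_update_weights:
  assumes "input_intact s" "idx s ''a'' 0 = 0"
  shows "halts update_weights s (m * 38 + 5) (\<lambda>t.
     (\<forall>y. y \<noteq> ''a'' \<longrightarrow> idx t y = idx s y) \<and>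
     (\<forall>y. y \<noteq> ''d'' \<longrightarrow> num t y = num s y) \<and>
     (\<forall>v. num t ''d'' v = num s ''d'' v + weight_to D w v {idx s ''j'' 0}))"
proof -
  define I :: "ram_state \<Rightarrow> bool" where "I = (\<lambda>t.
     (\<forall>y. y \<noteq> ''a'' \<longrightarrow> idx t y = idx s y) \<and>
     (\<forall>y. y \<noteq> ''d'' \<longrightarrow> num t y = num s y) \<and> idx t ''a'' 0 \<le> m \<and>
     (\<forall>v. num t ''d'' v = num s ''d'' v + weight_below (idx t ''a'' 0) v (idx s ''j'' 0)))"
  define V :: "ram_state \<Rightarrow> nat" where "V = (\<lambda>t. m - idx t ''a'' 0)"
  have I: "I s"
    using assms by (simp add: I_def weight_below_0)
  show ?thesis
    unfolding update_weights_def
    apply (rule halts_mono)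
      apply (rule halts_PWhile[where I = I and V = V])
       apply (rule halts_PSeq)
       apply (rule halts_PIf)
        apply (rule halts_NWrite)
        apply (rule halts_IWrite)
    subgoal using assms(1) by (auto simp: I_def V_def input_intact_def weight_below_Suc add.assoc)
       apply (rule halts_PSkip)
       apply (rule halts_IWrite)
    subgoal using assms(1) by (auto simp: I_def V_def input_intact_def weight_below_Suc)
      apply (rule I)
    subgoal by (simp add: V_def assms)
    subgoal using assms(1) by (auto simp: I_def input_intact_def weight_below_all[symmetric])
    done
qed

text \<open>The loop invariant; its last clause says that the vertices before the cursor are stuck.\<close>

definition greedy_inv :: "ram_state \<Rightarrow> bool" where
  "greedy_inv s \<longleftrightarrow> input_intact s \<and>
     (let L = map (idx s ''order'') [0..<idx s ''k'' 0] in
        partial_ordering D w f L \<and>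
        (\<forall>v<n. 0 < idx s ''used'' v \<longleftrightarrow> v \<in> set L) \<and>
        (\<forall>v<n. num s ''d'' v = weight_to D w v (set L)) \<and>
        idx s ''j'' 0 \<le> n \<and>
        (\<forall>v<idx s ''j'' 0. v \<notin> set L \<longrightarrow> weight_to D w v (set L) < f v))"

lemma partial_ordering_length_le: "partial_ordering D w f L \<Longrightarrow> length L \<le> n"
  using card_mono[of "{..<n}" "set L"] by (simp add: partial_ordering_def distinct_card verts_eq)

text \<open>Lexicographic: an appended vertex outweighs the return of the cursor from \<open>j \<le> n\<close> to \<open>0\<close>.\<close>

definition variant :: "ram_state \<Rightarrow> nat" where
  "variant s = (n - idx s ''k'' 0) * Suc n + (n - idx s ''j'' 0)"

lemma halts_greedy_step:
  assumes "greedy_inv s" "idx s ''j'' 0 < n"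
  shows "halts greedy_step s (m * 38 + 50) (\<lambda>t. greedy_inv t \<and> variant t < variant s)"
proof -
  let ?j = "idx s ''j'' 0" and ?k = "idx s ''k'' 0"
  let ?L = "map (idx s ''order'') [0..<?k]"
  have intact: "input_intact s" and L: "partial_ordering D w f ?L"
    and used: "\<And>v. v < n \<Longrightarrow> 0 < idx s ''used'' v \<longleftrightarrow> v \<in> set ?L"
    and d: "\<And>v. v < n \<Longrightarrow> num s ''d'' v = weight_to D w v (set ?L)"
    and stuck: "\<And>v. v < ?j \<Longrightarrow> v \<notin> set ?L \<Longrightarrow> weight_to D w v (set ?L) < f v"
    using assms(1) by (simp_all add: greedy_inv_def Let_def del: set_map)
  let ?append = "TAnd (ILess (IRead ''used'' (scalar ''j'')) (IConst 1))
    (TNot (NLess (NRead ''d'' (scalar ''j'')) (NRead ''f'' (scalar ''j''))))"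
  have test: "tval ?append s \<longleftrightarrow> ?j \<notin> set ?L \<and> f ?j \<le> weight_to D w ?j (set ?L)"
    using intact used[OF assms(2)] d[OF assms(2)] assms(2)
    by (auto simp: input_intact_def not_less simp del: set_map)
  \<comment> \<open>the state in which the stored weights are updated after the vertex \<open>?j\<close> has been appended\<close>
  define s' where "s' = iupd ''a'' 0 0 (iupd ''k'' 0 (Suc ?k)
    (iupd ''used'' ?j (Suc 0) (iupd ''order'' ?k ?j s)))"
  have "input_intact s'" "idx s' ''a'' 0 = 0"
    using intact by (simp_all add: s'_def input_intact_def)
  note update = halts_update_weights[OF this]
  have appended: "greedy_inv (iupd ''j'' 0 0 t) \<and> variant (iupd ''j'' 0 0 t) < variant s"
    if "tval ?append s" and idx: "\<forall>y. y \<noteq> ''a'' \<longrightarrow> idx t y = idx s' y"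
      and num: "\<forall>y. y \<noteq> ''d'' \<longrightarrow> num t y = num s' y"
      and d': "\<forall>v. num t ''d'' v = num s' ''d'' v + weight_to D w v {idx s' ''j'' 0}" for t
  proof -
    have "?j \<notin> set ?L" and f: "f ?j \<le> weight_to D w ?j (set ?L)"
      using that(1) test by blast+
    have k: "idx t ''k'' 0 = Suc ?k"
      using idx by (simp add: s'_def)
    have L': "map (idx t ''order'') [0..<Suc ?k] = ?L @ [?j]"
      using idx by (simp add: s'_def)
    have partial: "partial_ordering D w f (?L @ [?j])"
      using L _ \<open>?j \<notin> set ?L\<close> f by (rule partial_ordering_snoc) (simp add: verts_eq assms(2))
    have "weight_to D w v (set (?L @ [?j])) = num t ''d'' v" if "v < n" for v
      using d' d[OF that] weight_to_insert[OF fin_digraph_axioms \<open>?j \<notin> set ?L\<close>, of w v]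
      by (simp add: s'_def del: set_map)
    moreover have "0 < idx t ''used'' v \<longleftrightarrow> v \<in> set (?L @ [?j])" if "v < n" for v
      using used[OF that] idx by (auto simp: s'_def simp del: set_map)
    moreover have "input_intact (iupd ''j'' 0 0 t)"
      using intact idx num by (simp add: s'_def input_intact_def)
    ultimately have "greedy_inv (iupd ''j'' 0 0 t)"
      using partial by (simp add: greedy_inv_def k L' del: upt_Suc set_map set_append)
    moreover have "Suc ?k \<le> n"
      using partial_ordering_length_le[OF partial] by simp
    then have "variant (iupd ''j'' 0 0 t) < variant s"
      using k assms(2) by (simp add: variant_def Suc_diff_Suc[symmetric] Suc_le_eq)
    ultimately show ?thesis ..
  qed
  have skipped: "greedy_inv (iupd ''j'' 0 (Suc ?j) s) \<and> variant (iupd ''j'' 0 (Suc ?j) s) < variant s"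
    if "\<not> tval ?append s"
  proof -
    have "weight_to D w v (set ?L) < f v" if "v < Suc ?j" "v \<notin> set ?L" for v
      using stuck that \<open>\<not> tval ?append s\<close> test not_le by (metis less_SucE)
    then show ?thesis
      using assms
      by (auto simp: greedy_inv_def variant_def input_intact_def Let_def simp del: set_map)
  qed
  have finish: "halts (PSeq update_weights (assign ''j'' (IConst 0))) s' (m * 38 + 8)
      (\<lambda>t. greedy_inv t \<and> variant t < variant s)" if "tval ?append s"
    apply (rule halts_le)
     apply (rule halts_PSeq)
     apply (rule halts_mono[OF update order.refl])
     apply (rule halts_IWrite)
     apply (simp add: appended[OF that])
    apply simp
    done
  show ?thesis
    unfolding greedy_step_def
    apply (rule halts_le)
     apply (rule halts_PIf)
      apply (rule halts_PSeq, rule halts_IWrite)+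
      apply (simp (no_asm) flip: s'_def)
      apply (erule finish)
     apply (rule halts_IWrite)
    subgoal using skipped by simp
    apply simp
    done
qed

text \<open>
  When the cursor has reached \<open>n\<close>, the vertices missing from the list, if any, form a blocking set.
\<close>

lemma bounded_ordering_if_finished:
  assumes "greedy_inv s" "\<not> idx s ''j'' 0 < n"
  shows "if idx s ''k'' 0 < n then \<not> (\<exists>\<sigma>. bounded_ordering D w f \<sigma>)
    else bounded_ordering D w f (map (idx s ''order'') [0..<n])"
proof -
  let ?L = "map (idx s ''order'') [0..<idx s ''k'' 0]"
  have L: "partial_ordering D w f ?L"
    using assms(1) by (simp add: greedy_inv_def Let_def)
  then have card: "card (set ?L) = idx s ''k'' 0" and subset: "set ?L \<subseteq> verts D"
    by (simp_all add: partial_ordering_def distinct_card del: set_map)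
  show ?thesis
  proof (cases "idx s ''k'' 0 < n")
    case True
    have "set ?L \<noteq> verts D"
      using card True verts_eq by (metis card_lessThan less_irrefl)
    then have "blocking_set D w f (verts D - set ?L)"
      using subset assms
      by (intro blocking_set_if_stuck) (auto simp: greedy_inv_def Let_def verts_eq simp del: set_map)
    with True show ?thesis
      using not_bounded_ordering_if_blocking_set[OF inst] by auto
  next
    case False
    then have "idx s ''k'' 0 = n"
      using partial_ordering_length_le[OF L] by simp
    moreover have "set ?L = verts D"
      using card_subset_eq[OF finite_verts subset] card verts_eq calculation by simp
    ultimately show ?thesis
      using L by (simp add: bounded_ordering_iff_partial del: set_map)
  qed
qed

lemma halts_greedy_program:
  "halts greedy_program (encode (D, w, f)) ((n + 1) * (n + 1) * (m * 38 + 55) + 20)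
     (correct_output (D, w, f))"
proof -
  let ?s = "encode (D, w, f)"
  have init: "greedy_inv ?s"
    by (auto simp: greedy_inv_def input_intact_def encode_def verts_eq arcs_eq partial_ordering_Nil)
  have n: "idx s ''n'' 0 = n" if "greedy_inv s" for s
    using that by (simp add: greedy_inv_def input_intact_def)
  have loop: "halts (PWhile (ILess (scalar ''j'') (scalar ''n'')) greedy_step) ?s
      (variant ?s * (m * 38 + 55) + 5) (\<lambda>t. greedy_inv t \<and> \<not> idx t ''j'' 0 < n)"
    apply (rule halts_mono)
      apply (rule halts_PWhile[where I = greedy_inv and V = variant, OF halts_greedy_step init])
       apply assumption
      apply (simp add: n)
     apply simp
    apply (auto simp: n)
    done
  have "variant ?s \<le> (n + 1) * (n + 1)"
    by (simp add: variant_def encode_def)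
  then have time: "variant ?s * (m * 38 + 55) \<le> (n + 1) * (n + 1) * (m * 38 + 55)"
    by (rule mult_le_mono1)
  show ?thesis
    unfolding greedy_program_def
    apply (rule halts_le)
     apply (rule halts_PSeq)
     apply (rule halts_mono[OF loop order.refl])
     apply (rule halts_PIf)
      apply (rule halts_IWrite)
    subgoal for t
      using bounded_ordering_if_finished[of t]
      by (auto simp: correct_output_def n verts_eq)
     apply (rule halts_IWrite)
    subgoal for t
      using bounded_ordering_if_finished[of t]
      by (auto simp: correct_output_def n verts_eq)
    using time apply simp
    done
qed

end

theorem polynomial_time_solvable_bounded_ordering:
  "polynomial_time_solvable numbered_instances encode instance_size correct_output"
proof -
  let ?b = "[:55:] * [:1, 1:] ^ 3 + [:20:] :: nat poly"
  have "\<exists>k t. runs greedy_program (encode x) k t \<and> k \<le> poly ?b (instance_size x) \<and>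
      correct_output x t" if mem: "x \<in> numbered_instances" for x
  proof -
    obtain D w f n m where x: "x = (D, w, f)" and D: "bounded_ordering_instance D w f"
      "verts D = {..<n}" "arcs D = {..<m}"
      using mem by (auto simp: numbered_instances_def)
    interpret numbered_instance D w f n m
      using D by unfold_locales
    have "(n + 1) * (n + 1) * (m * 38 + 55) \<le> (n + m + 1) * (n + m + 1) * ((n + m + 1) * 55)"
      by (intro mult_le_mono) simp_all
    moreover have "poly ?b (instance_size x) =
        (n + m + 1) * (n + m + 1) * ((n + m + 1) * 55) + 20"
      by (simp add: x instance_size_def verts_eq arcs_eq power3_eq_cube algebra_simps)
    ultimately have "(n + 1) * (n + 1) * (m * 38 + 55) + 20 \<le> poly ?b (instance_size x)"
      by linarith
    then show ?thesis
      using halts_le[OF halts_greedy_program] x by (simp add: halts_def)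
  qed
  then show ?thesis
    unfolding polynomial_time_solvable_def by blast
qed

theorem theorem2p3:
  shows "polynomial_time_solvable numbered_instances encode instance_size correct_output \<and>
    (\<forall>(D :: ('a, 'b) pre_digraph) (w :: 'b \<Rightarrow> ereal) (f :: 'a \<Rightarrow> ereal).
       bounded_ordering_instance D w f \<longrightarrow>
       ((\<exists>\<sigma>. bounded_ordering D w f \<sigma>) \<longleftrightarrow>
        \<not> (\<exists>D'. induced_subgraph D' D \<and> verts D' \<noteq> {} \<and>
             (\<forall>v\<in>verts D'. weight_to D w v (verts D - verts D') < f v))))"
proof (intro conjI allI impI)
  show "polynomial_time_solvable numbered_instances encode instance_size correct_output"
    by (rule polynomial_time_solvable_bounded_ordering)
next
  fix D :: "('a, 'b) pre_digraph" and w :: "'b \<Rightarrow> ereal" and f :: "'a \<Rightarrow> ereal"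
  assume inst: "bounded_ordering_instance D w f"
  then interpret fin_digraph D
    by (simp add: bounded_ordering_instance_def)
  show "(\<exists>\<sigma>. bounded_ordering D w f \<sigma>) \<longleftrightarrow>
      \<not> (\<exists>D'. induced_subgraph D' D \<and> verts D' \<noteq> {} \<and>
           (\<forall>v\<in>verts D'. weight_to D w v (verts D - verts D') < f v))"
    using ex_bounded_ordering_iff_no_blocking_set[OF inst]
      ex_blocking_set_iff_ex_induced_subgraph[OF wf_digraph_axioms] by blast
qed

end
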